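(* Let $T:X\times W\to X$ be a stochastic system whose noise takes finitely many values, with equilibrium point $x=0\in X_0=D_1\subset X$ whose local domain of attraction $\mathcal O$ is contained inside $X_0$. Let $\mathbb P_1$ be the sub-Markov operator on measures on $E^c=X\setminus\{0\}$, and let $P_1$ be its finite dimensional approximation obtained with respect to the partition $\mathcal X_1=\{D_2,\dots,D_L\}$ of the complement set $X_1=X\setminus X_0$. Then: 1) Suppose a Lyapunov measure $\bar\mu$ exists such that $$[\mathbb P_1\bar\mu](B)<\bar\mu(B)$$ for all $B\in\mathcal B(X_1)$ with $\bar\mu(B)>0$, and additionally $\bar\mu$ is equivalent to Lebesgue measure $m$. Then the finite-dimensional approximation $P_1$ is transient. 2) Suppose $P_1$ is transient. Then the equilibrium point $x=0$ is (stochastic) coarse stable with respect to the initial conditions in $X_1$.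
   Context: Setting. $X\subset\mathbb{R}^d$ is compact with $0\in X$, $\mathcal B(\cdot)$ denotes Borel $\sigma$-algebras, $m$ is Lebesgue measure. The system is $x_{n+1}=T(x_n,\xi_n)$ with $\xi_0,\xi_1,\dots$ i.i.d., taking finitely many values $w_1,\dots,w_Q$ with $\mathrm{Prob}\{\xi_n=w_\ell\}=p_\ell$. Write $T_{w_\ell}=T(\cdot,w_\ell):X\to X$, which is continuous. Equilibrium: $T(0,w_\ell)=0$ for all $\ell$. Local stability: there is a neighborhood $\mathcal O$ of $0$ such that for every deterministic initial condition $x_0\in\mathcal O$, $\mathrm{Prob}\{x_n\in\mathcal O\}=1$ for all $n\ge0$ and $\mathrm{Prob}\{\lim_{n\to\infty}x_n=0\}=1$. Partition: $\mathcal X=\{D_1,\dots,D_L\}$ is a finite partition of $X$ into Borel cells with $m(D_i)>0$; the cell $D_1$ contains $0$, and the partition is assumed sufficiently fine that $D_1\subset\mathcal O$. $X_0=D_1$, $X_1=\bigcup_{k=2}^LD_k$, $\mathcal X_1=\{D_2,\dots,D_L\}$. Operator: with $E^c=X\setminus\{0\}$, for a positive measure $\mu$ on $E^c$ and $B\in\mathcal B(E^c)$, $[\mathbb P_1\mu](B)=\sum_{\ell=1}^Qp_\ell\,\mu(T_{w_\ell}^{-1}(B)\cap E^c)$. Finite dimensional approximation: $P_1$ is the $(L-1)\times(L-1)$ sub-Markov matrix with entries $[P_1]_{ij}=\sum_{\ell=1}^Qp_\ell\,\dfrac{m(T_{w_\ell}^{-1}(D_j)\cap D_i)}{m(D_i)}$,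 $2\le i,j\le L$. A sub-Markov matrix $P_1$ is transient (has only transient states) if $P_1^n\to0$ element-wise as $n\to\infty$. Lyapunov measure here: a positive measure $\bar\mu$ on $E^c$, finite outside every neighborhood $U(\epsilon)$ of $0$, $\epsilon>0$, satisfying the displayed inequality. Two measures $\mu,\vartheta$ are equivalent if for every Borel set $B$ (here in $E^c$), $\mu(B)=0$ if and only if $\vartheta(B)=0$. Stochastic coarse stability: $x=0$ is stochastic coarse stable with respect to initial conditions in $X_1$ if, for every attractor set $B\subset U\subset X_1$ with domain of attraction $U$, there exists no (nonempty) subpartition $\mathcal S=\{D_{s_1},\dots,D_{s_l}\}$ of $\mathcal X_1$ with domain $S=\bigcup_{k=1}^lD_{s_k}$ such that $B\subset S\subset U$ and $\mathrm{Prob}\{T(x,\xi)\in S\}=1$ for all $x\in S$. *)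

theory Defs
  imports "HOL-Probability.Probability" "Jordan_Normal_Form.Matrix"
begin

primrec trajectory ::
  "('a \<Rightarrow> 'w \<Rightarrow> 'a) \<Rightarrow> (nat \<Rightarrow> 'o \<Rightarrow> 'w) \<Rightarrow> 'a \<Rightarrow> nat \<Rightarrow> 'o \<Rightarrow> 'a" where
  "trajectory T \<xi> x 0 \<omega> = x"
| "trajectory T \<xi> x (Suc n) \<omega> = T (trajectory T \<xi> x n \<omega>) (\<xi> n \<omega>)"

(* X is the state space, w 1, ..., w Q are the noise values and p l is the probability of w l. *)
locale noisy_system = prob_space M for M :: "'o measure" +
  fixes \<xi> :: "nat \<Rightarrow> 'o \<Rightarrow> 'w"
    and X :: "'a :: euclidean_space set"
    and T :: "'a \<Rightarrow> 'w \<Rightarrow> 'a"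
    and Q :: nat
    and w :: "nat \<Rightarrow> 'w"
    and p :: "nat \<Rightarrow> real"
  assumes compact_X: "compact X"
    and zero_in_X: "0 \<in> X"
    and inj_w: "inj_on w {1..Q}"
    and noise_indep: "indep_vars (\<lambda>_. count_space (w ` {1..Q})) \<xi> UNIV"
    and noise_distr: "\<And>n l. l \<in> {1..Q} \<Longrightarrow> \<P>(\<omega> in M. \<xi> n \<omega> = w l) = p l"
    and T_into: "\<And>l. l \<in> {1..Q} \<Longrightarrow> (\<lambda>x. T x (w l)) \<in> X \<rightarrow> X"
    and T_cont: "\<And>l. l \<in> {1..Q} \<Longrightarrow> continuous_on X (\<lambda>x. T x (w l))"
    and T_equilibrium: "\<And>l. l \<in> {1..Q} \<Longrightarrow> T 0 (w l) = 0"

(* N need not be open; neighborhoods are taken in the subspace X. *)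
definition nhood_in :: "'a :: topological_space set \<Rightarrow> 'a set \<Rightarrow> 'a set \<Rightarrow> bool" where
  "nhood_in X A N \<longleftrightarrow> N \<subseteq> X \<and> (\<exists>V. open V \<and> A \<subseteq> V \<and> V \<inter> X \<subseteq> N)"

definition locally_stable ::
  "'o measure \<Rightarrow> (nat \<Rightarrow> 'o \<Rightarrow> 'w) \<Rightarrow> 'a :: euclidean_space set \<Rightarrow> ('a \<Rightarrow> 'w \<Rightarrow> 'a) \<Rightarrow> 'a set \<Rightarrow> bool"
where
  "locally_stable M \<xi> X T \<O> \<longleftrightarrow> nhood_in X {0} \<O> \<and>
     (\<forall>x\<in>\<O>. (\<forall>n. \<P>(\<omega> in M. trajectory T \<xi> x n \<omega> \<in> \<O>) = 1) \<and>
            \<P>(\<omega> in M. (\<lambda>n. trajectory T \<xi> x n \<omega>) \<longlonglongrightarrow> 0) = 1)"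

definition cell_partition :: "'a :: euclidean_space set \<Rightarrow> nat \<Rightarrow> (nat \<Rightarrow> 'a set) \<Rightarrow> bool" where
  "cell_partition X L D \<longleftrightarrow> 1 \<le> L \<and> disjoint_family_on D {1..L} \<and> (\<Union>k\<in>{1..L}. D k) = X \<and>
     (\<forall>k\<in>{1..L}. D k \<in> sets borel \<and> emeasure lborel (D k) > 0) \<and> 0 \<in> D 1"

definition complement_cells :: "nat \<Rightarrow> (nat \<Rightarrow> 'a set) \<Rightarrow> 'a set" where
  "complement_cells L D = (\<Union>k\<in>{2..L}. D k)"

abbreviation punctured :: "'a :: euclidean_space set \<Rightarrow> 'a set" where
  "punctured X \<equiv> X - {0}"

definition sub_Markov_op ::
  "'a :: euclidean_space set \<Rightarrow> ('a \<Rightarrow> 'w \<Rightarrow> 'a) \<Rightarrow> nat \<Rightarrow> (nat \<Rightarrow> 'w) \<Rightarrow> (nat \<Rightarrow> real) \<Rightarrow>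
     'a measure \<Rightarrow> 'a measure"
where
  "sub_Markov_op X T Q w p \<mu> =
     measure_of (punctured X) (sets (restrict_space borel (punctured X)))
       (\<lambda>B. \<Sum>l=1..Q. ennreal (p l) *
               emeasure \<mu> (((\<lambda>x. T x (w l)) -` B \<inter> X) \<inter> punctured X))"

(* Row and column indices are shifted: entry (i, j) belongs to the cells D (i + 2) and D (j + 2). *)
definition sub_Markov_mat ::
  "'a :: euclidean_space set \<Rightarrow> ('a \<Rightarrow> 'w \<Rightarrow> 'a) \<Rightarrow> nat \<Rightarrow> (nat \<Rightarrow> 'w) \<Rightarrow> (nat \<Rightarrow> real) \<Rightarrow>
     nat \<Rightarrow> (nat \<Rightarrow> 'a set) \<Rightarrow> real mat"
where
  "sub_Markov_mat X T Q w p L D =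
     mat (L - 1) (L - 1) (\<lambda>(i, j). \<Sum>l=1..Q. p l *
       (measure lborel (((\<lambda>x. T x (w l)) -` D (j + 2) \<inter> X) \<inter> D (i + 2)) /
        measure lborel (D (i + 2))))"

definition transient_mat :: "real mat \<Rightarrow> bool" where
  "transient_mat P \<longleftrightarrow>
     (\<forall>i<dim_row P. \<forall>j<dim_col P. (\<lambda>n. (P ^\<^sub>m n) $$ (i, j)) \<longlonglongrightarrow> 0)"

definition equivalent_measures :: "'a measure \<Rightarrow> 'a measure \<Rightarrow> bool" where
  "equivalent_measures \<mu> \<theta> \<longleftrightarrow> sets \<mu> = sets \<theta> \<and>
     (\<forall>B\<in>sets \<mu>. emeasure \<mu> B = 0 \<longleftrightarrow> emeasure \<theta> B = 0)"

definition Lyapunov_measure ::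
  "'a :: euclidean_space set \<Rightarrow> ('a \<Rightarrow> 'w \<Rightarrow> 'a) \<Rightarrow> nat \<Rightarrow> (nat \<Rightarrow> 'w) \<Rightarrow> (nat \<Rightarrow> real) \<Rightarrow>
     'a set \<Rightarrow> 'a measure \<Rightarrow> bool"
where
  "Lyapunov_measure X T Q w p X1 \<mu> \<longleftrightarrow>
     sets \<mu> = sets (restrict_space borel (punctured X)) \<and>
     (\<forall>\<epsilon>>0. emeasure \<mu> (punctured X - ball 0 \<epsilon>) < \<infinity>) \<and>
     (\<forall>B\<in>sets (restrict_space borel X1). emeasure \<mu> B > 0 \<longrightarrow>
        emeasure (sub_Markov_op X T Q w p \<mu>) B < emeasure \<mu> B)"

definition attraction_basin ::
  "'o measure \<Rightarrow> (nat \<Rightarrow> 'o \<Rightarrow> 'w) \<Rightarrow> 'a :: euclidean_space set \<Rightarrow> ('a \<Rightarrow> 'w \<Rightarrow> 'a) \<Rightarrow> 'a set \<Rightarrow> 'a set"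
where
  "attraction_basin M \<xi> X T B =
     {x \<in> X. \<P>(\<omega> in M. (\<lambda>n. infdist (trajectory T \<xi> x n \<omega>) B) \<longlonglongrightarrow> 0) = 1}"

(* The variables \<xi> n are identically distributed, so \<xi> 0 stands for all of them. *)
definition invariant_as ::
  "'o measure \<Rightarrow> (nat \<Rightarrow> 'o \<Rightarrow> 'w) \<Rightarrow> ('a \<Rightarrow> 'w \<Rightarrow> 'a) \<Rightarrow> 'a set \<Rightarrow> bool"
where
  "invariant_as M \<xi> T S \<longleftrightarrow> (\<forall>x\<in>S. \<P>(\<omega> in M. T x (\<xi> 0 \<omega>) \<in> S) = 1)"

(* U is a neighborhood of B all of whose points are attracted to B almost surely. It need not be
   the whole basin: a domain of attraction may be local, as for the equilibrium itself. *)
definition attractor_with_domain ::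
  "'o measure \<Rightarrow> (nat \<Rightarrow> 'o \<Rightarrow> 'w) \<Rightarrow> 'a :: euclidean_space set \<Rightarrow> ('a \<Rightarrow> 'w \<Rightarrow> 'a) \<Rightarrow>
     'a set \<Rightarrow> 'a set \<Rightarrow> bool"
where
  "attractor_with_domain M \<xi> X T B U \<longleftrightarrow> B \<noteq> {} \<and> closed B \<and> invariant_as M \<xi> T B \<and>
     nhood_in X B U \<and> B \<subseteq> U \<and> U \<subseteq> attraction_basin M \<xi> X T B"

definition coarse_stable ::
  "'o measure \<Rightarrow> (nat \<Rightarrow> 'o \<Rightarrow> 'w) \<Rightarrow> 'a :: euclidean_space set \<Rightarrow> ('a \<Rightarrow> 'w \<Rightarrow> 'a) \<Rightarrow>
     nat \<Rightarrow> (nat \<Rightarrow> 'a set) \<Rightarrow> bool"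
where
  "coarse_stable M \<xi> X T L D \<longleftrightarrow>
     (\<forall>B U. attractor_with_domain M \<xi> X T B U \<and> U \<subseteq> complement_cells L D \<longrightarrow>
        \<not> (\<exists>I. I \<subseteq> {2..L} \<and> I \<noteq> {} \<and>
              B \<subseteq> (\<Union>k\<in>I. D k) \<and> (\<Union>k\<in>I. D k) \<subseteq> U \<and> invariant_as M \<xi> T (\<Union>k\<in>I. D k)))"

context noisy_system
begin

lemma T_vimage_sets:
  assumes "l \<in> {1..Q}" "B \<in> sets borel"
  shows "((\<lambda>x. T x (w l)) -` B \<inter> X) \<inter> punctured X \<in> sets borel"
proof -
  have X: "X \<in> sets borel"
    using compact_X by (simp add: borel_compact)
  have "(\<lambda>x. T x (w l)) \<in> borel_measurable (restrict_space borel X)"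
    using T_cont[OF assms(1)] by (rule borel_measurable_continuous_on_restrict)
  then have "(\<lambda>x. T x (w l)) -` B \<inter> space (restrict_space borel X) \<in> sets (restrict_space borel X)"
    using assms(2) by (rule measurable_sets)
  then have "(\<lambda>x. T x (w l)) -` B \<inter> X \<in> sets borel"
    using X by (simp add: sets_restrict_space_iff space_restrict_space)
  then show ?thesis
    using X by auto
qed

(* The set function in the definition of sub_Markov_op is a measure, so it is not lost
   in measure_of. *)
lemma emeasure_sub_Markov_op:
  assumes \<mu>: "sets \<mu> = sets (restrict_space borel (punctured X))"
    and B: "B \<in> sets (restrict_space borel (punctured X))"
  shows "emeasure (sub_Markov_op X T Q w p \<mu>) B =
    (\<Sum>l=1..Q. ennreal (p l) * emeasure \<mu> (((\<lambda>x. T x (w l)) -` B \<inter> X) \<inter> punctured X))"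
proof -
  let ?E = "punctured X"
  let ?A = "sets (restrict_space borel ?E)"
  let ?v = "\<lambda>l B. ((\<lambda>x. T x (w l)) -` B \<inter> X) \<inter> ?E"
  let ?f = "\<lambda>B. \<Sum>l=1..Q. ennreal (p l) * emeasure \<mu> (?v l B)"
  have X: "X \<in> sets borel"
    using compact_X by (simp add: borel_compact)
  have A: "C \<in> ?A \<longleftrightarrow> C \<in> sets borel \<and> C \<subseteq> ?E" for C
    using X by (subst sets_restrict_space_iff) auto
  have v: "?v l C \<in> sets \<mu>" if "l \<in> {1..Q}" "C \<in> ?A" for l C
    using T_vimage_sets[OF that(1), of C] that(2) unfolding \<mu> A by auto
  have sa: "sigma_algebra ?E ?A"
    using sets.sigma_algebra_axioms[of "restrict_space borel ?E"]
    by (simp add: space_restrict_space)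
  have "positive ?A ?f"
    by (simp add: positive_def)
  moreover have "countably_additive ?A ?f"
  proof (rule countably_additiveI)
    fix F :: "nat \<Rightarrow> 'a set"
    assume F: "range F \<subseteq> ?A" "disjoint_family F"
    have eq: "(\<Sum>i. emeasure \<mu> (?v l (F i))) = emeasure \<mu> (?v l (\<Union>i. F i))" if "l \<in> {1..Q}" for l
    proof -
      have "range (\<lambda>i. ?v l (F i)) \<subseteq> sets \<mu>"
        using F(1) v[OF that] by blast
      moreover have "disjoint_family (\<lambda>i. ?v l (F i))"
        using F(2) unfolding disjoint_family_on_def by blast
      ultimately have "(\<Sum>i. emeasure \<mu> (?v l (F i))) = emeasure \<mu> (\<Union>i. ?v l (F i))"
        by (rule suminf_emeasure)
      also have "(\<Union>i. ?v l (F i)) = ?v l (\<Union>i. F i)"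
        by blast
      finally show ?thesis .
    qed
    have "(\<Sum>i. ?f (F i)) = (\<Sum>l=1..Q. \<Sum>i. ennreal (p l) * emeasure \<mu> (?v l (F i)))"
      by (rule suminf_sum) simp
    also have "\<dots> = ?f (\<Union>i. F i)"
      by (intro sum.cong refl) (simp only: ennreal_suminf_cmult eq)
    finally show "(\<Sum>i. ?f (F i)) = ?f (\<Union> (range F))" .
  qed
  ultimately have "emeasure (measure_of ?E ?A ?f) B = ?f B"
    using sa B by (intro emeasure_measure_of_sigma)
  then show ?thesis
    by (simp only: sub_Markov_op_def)
qed

end

end

theory Submission
  imports Defs
begin

text \<open>
  Both implications pass through the same combinatorial obstruction. A substochastic matrix fails
  to be transient exactly when some nonempty set of states is closed, that is, every row indexed
  by it carries full mass \<open>1\<close> inside it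
  (\<open>no_stochastically_closed_imp_transient\<close>, \<open>stochastically_closed_imp_not_transient\<close>).

  For the cell matrix, the mass missing from such a row is the weighted share of the cell that
  the branches \<open>T (\<cdot>, w l)\<close> throw out of the union \<open>S\<close> of the chosen cells
  (\<open>sub_Markov_mat_row_sum\<close>). So closed sets of states are exactly unions \<open>S\<close> of cells that
  every branch of positive weight maps into \<open>S\<close> up to a Lebesgue null set
  (\<open>transient_sub_Markov_mat_iff\<close>).

  Such an \<open>S\<close> is incompatible with the Lyapunov inequality: the null sets are also null for an
  equivalent measure \<open>\<mu>\<close>, so the preimage of \<open>S\<close> under each branch of positive weight has at
  least the mass \<open>\<mu> S\<close>, the weights sum to one, and \<open>S\<close> has positive mass; this contradicts the
  strict decrease of \<open>\<mu> S\<close> under the operator. Conversely, a subpartition whose domain is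
  almost surely invariant is such an \<open>S\<close>, even without exceptional null sets. Transience thus
  excludes every invariant subpartition, in particular those between an attractor and its domain
  of attraction.
\<close>

section \<open>Transience of substochastic matrices\<close>

definition substochastic_mat :: "nat \<Rightarrow> real mat \<Rightarrow> bool" where
  "substochastic_mat n A \<longleftrightarrow> A \<in> carrier_mat n n \<and>
     (\<forall>i<n. \<forall>j<n. 0 \<le> A $$ (i, j)) \<and> (\<forall>i<n. (\<Sum>j<n. A $$ (i, j)) \<le> 1)"

text \<open>
  For a substochastic matrix this says that the chain neither leaves \<open>K\<close> nor loses mass there.
\<close>

definition stochastically_closed :: "real mat \<Rightarrow> nat set \<Rightarrow> bool" where
  "stochastically_closed A K \<longleftrightarrow> (\<forall>i\<in>K. (\<Sum>j\<in>K. A $$ (i, j)) = 1)"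

lemma pow_mat_Suc_index:
  assumes "A \<in> carrier_mat n n" "i < n" "j < n"
  shows "(A ^\<^sub>m Suc k) $$ (i, j) = (\<Sum>h<n. (A ^\<^sub>m k) $$ (i, h) * A $$ (h, j))"
proof -
  have "A ^\<^sub>m k \<in> carrier_mat n n"
    using assms(1) by simp
  then show ?thesis
    using assms by (simp add: scalar_prod_def atLeast0LessThan)
qed

lemma pow_mat_nonneg:
  fixes A :: "real mat"
  assumes "A \<in> carrier_mat n n" "\<And>i j. i < n \<Longrightarrow> j < n \<Longrightarrow> 0 \<le> A $$ (i, j)" "i < n" "j < n"
  shows "0 \<le> (A ^\<^sub>m k) $$ (i, j)"
  using assms(3,4)
proof (induction k arbitrary: i j)
  case 0
  then show ?case using assms(1) by auto
next
  case (Suc k)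
  then show ?case
    using assms(1,2) by (simp only: pow_mat_Suc_index) (auto intro!: sum_nonneg mult_nonneg_nonneg)
qed

text \<open>
  The power \<open>A ^\<^sub>m Suc k\<close> multiplies by \<open>A\<close> on the right, whereas the monotone limit of the row
  sums needs the outermost factor on the left. The induction turns one into the other by
  absorbing a factor into \<open>v\<close>, so \<open>v\<close> has to be arbitrary.
\<close>

lemma pow_mat_row_sum:
  fixes A :: "real mat"
  assumes A: "A \<in> carrier_mat n n" and i: "i < n"
  shows "(\<Sum>j<n. (A ^\<^sub>m k) $$ (i, j) * v j) = ((\<lambda>u h. \<Sum>j<n. A $$ (h, j) * u j) ^^ k) v i"
proof (induction k arbitrary: v)
  case 0
  have "(\<Sum>j<n. (A ^\<^sub>m 0) $$ (i, j) * v j) = (\<Sum>j<n. if i = j then v j else 0)"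
    using A i by (intro sum.cong) auto
  then show ?case
    using i by simp
next
  case (Suc k)
  let ?F = "\<lambda>u h. \<Sum>j<n. A $$ (h, j) * u j"
  have "(\<Sum>j<n. (A ^\<^sub>m Suc k) $$ (i, j) * v j) =
      (\<Sum>j<n. \<Sum>h<n. (A ^\<^sub>m k) $$ (i, h) * A $$ (h, j) * v j)"
    using A i by (intro sum.cong refl) (simp only: pow_mat_Suc_index lessThan_iff sum_distrib_right)
  also have "\<dots> = (\<Sum>h<n. (A ^\<^sub>m k) $$ (i, h) * ?F v h)"
    by (subst sum.swap) (simp add: sum_distrib_left mult.assoc)
  also have "\<dots> = (?F ^^ Suc k) v i"
    by (simp only: Suc.IH funpow_Suc_right comp_def)
  finally show ?case .
qed

text \<open>
  The probability mass starting in a closed set never leaves it, so the powers of the matrix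
  cannot tend to zero there.
\<close>

lemma stochastically_closed_imp_not_transient:
  assumes A: "A \<in> carrier_mat n n" "\<And>i j. i < n \<Longrightarrow> j < n \<Longrightarrow> 0 \<le> A $$ (i, j)"
    and K: "K \<subseteq> {..<n}" "K \<noteq> {}" "stochastically_closed A K"
  shows "\<not> transient_mat A"
proof
  assume tr: "transient_mat A"
  obtain i where i: "i \<in> K"
    using K(2) by blast
  then have "i < n"
    using K(1) by auto
  have fin: "finite K"
    using K(1) finite_subset by blast
  have mass: "1 \<le> (\<Sum>j\<in>K. (A ^\<^sub>m k) $$ (i, j))" for k
  proof (induction k)
    case 0
    have "(\<Sum>j\<in>K. (A ^\<^sub>m 0) $$ (i, j)) = (\<Sum>j\<in>K. if i = j then 1 else 0)"
      using A \<open>i < n\<close> K(1) by (intro sum.cong) auto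
    then show ?case
      using fin i by simp
  next
    case (Suc k)
    have "(\<Sum>h\<in>K. (A ^\<^sub>m k) $$ (i, h)) = (\<Sum>h\<in>K. (A ^\<^sub>m k) $$ (i, h) * (\<Sum>j\<in>K. A $$ (h, j)))"
      using K(3) by (simp add: stochastically_closed_def)
    also have "\<dots> \<le> (\<Sum>h<n. (A ^\<^sub>m k) $$ (i, h) * (\<Sum>j\<in>K. A $$ (h, j)))"
      using K(1) A \<open>i < n\<close> by (intro sum_mono2) (auto intro!: mult_nonneg_nonneg sum_nonneg pow_mat_nonneg[of A n])
    also have "\<dots> = (\<Sum>j\<in>K. \<Sum>h<n. (A ^\<^sub>m k) $$ (i, h) * A $$ (h, j))"
      by (subst sum.swap) (simp add: sum_distrib_left)
    also have "\<dots> = (\<Sum>j\<in>K. (A ^\<^sub>m Suc k) $$ (i, j))"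
      using A(1) \<open>i < n\<close> K(1) by (intro sum.cong refl pow_mat_Suc_index[symmetric]) auto
    finally show ?case
      using Suc.IH by linarith
  qed
  have "(\<lambda>k. \<Sum>j\<in>K. (A ^\<^sub>m k) $$ (i, j)) \<longlonglongrightarrow> (\<Sum>j\<in>K. 0)"
    using tr A(1) K(1) \<open>i < n\<close> by (intro tendsto_sum) (auto simp: transient_mat_def)
  then have "(1::real) \<le> 0"
    using mass by (intro LIMSEQ_le_const) auto
  then show False
    by simp
qed

text \<open>
  The row sums of the powers decrease to a nonnegative limit \<open>r\<close> that is a fixed point of the
  matrix. By the maximum principle, the set where a positive \<open>r\<close> would attain its maximum
  is closed: at a maximal index the value \<open>r i\<close> is a substochastic average of the values
  \<open>r j\<close>, so all mass must sit on maximal indices. Hence without closed sets the limit is zero.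
\<close>

lemma no_stochastically_closed_imp_transient:
  assumes A: "substochastic_mat n A"
    and no: "\<And>K. K \<subseteq> {..<n} \<Longrightarrow> K \<noteq> {} \<Longrightarrow> \<not> stochastically_closed A K"
  shows "transient_mat A"
proof -
  have car: "A \<in> carrier_mat n n" and nn: "\<And>i j. i < n \<Longrightarrow> j < n \<Longrightarrow> 0 \<le> A $$ (i, j)"
    and row: "\<And>i. i < n \<Longrightarrow> (\<Sum>j<n. A $$ (i, j)) \<le> 1"
    using A by (auto simp: substochastic_mat_def)
  define F where "F = (\<lambda>u h. \<Sum>j<n. A $$ (h, j) * (u j :: real))"
  define s where "s k = (F ^^ k) (\<lambda>_. 1)" for k
  have s_Suc: "s (Suc k) i = (\<Sum>j<n. A $$ (i, j) * s k j)" for k i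
    by (simp add: s_def F_def)
  have s_eq: "(\<Sum>j<n. (A ^\<^sub>m k) $$ (i, j)) = s k i" if "i < n" for k i
    using pow_mat_row_sum[OF car that, of k "\<lambda>_. 1"] by (simp add: s_def F_def)
  have s_nonneg: "0 \<le> s k i" if "i < n" for k i
    unfolding s_eq[OF that, symmetric] using car nn that by (intro sum_nonneg pow_mat_nonneg[of A n]) auto
  have s_dec: "s (Suc k) i \<le> s k i" if "i < n" for k i
    using that
  proof (induction k arbitrary: i)
    case 0
    then show ?case
      using row by (simp only: s_Suc) (simp add: s_def)
  next
    case (Suc k)
    have "s (Suc (Suc k)) i \<le> (\<Sum>j<n. A $$ (i, j) * s k j)"
      unfolding s_Suc[of "Suc k"] using Suc nn by (intro sum_mono mult_left_mono) auto
    then show ?case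
      by (simp only: s_Suc)
  qed
  have "\<exists>l. (\<lambda>k. s k i) \<longlonglongrightarrow> l" if "i < n" for i
  proof -
    have "decseq (\<lambda>k. s k i)"
      using s_dec[OF that] by (rule decseq_SucI)
    from decseq_convergent[OF this, of 0] s_nonneg[OF that] show ?thesis
      by metis
  qed
  then obtain r where r: "\<And>i. i < n \<Longrightarrow> (\<lambda>k. s k i) \<longlonglongrightarrow> r i"
    by metis
  have r_nonneg: "0 \<le> r i" if "i < n" for i
    using r[OF that] s_nonneg[OF that] by (intro LIMSEQ_le_const) auto
  have r_fix: "r i = (\<Sum>j<n. A $$ (i, j) * r j)" if "i < n" for i
  proof (rule LIMSEQ_unique)
    show "(\<lambda>k. s (Suc k) i) \<longlonglongrightarrow> r i"
      using r[OF that] by (rule LIMSEQ_Suc)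
    show "(\<lambda>k. s (Suc k) i) \<longlonglongrightarrow> (\<Sum>j<n. A $$ (i, j) * r j)"
      unfolding s_Suc using r by (intro tendsto_intros) auto
  qed
  have r_zero: "r i = 0" if i: "i < n" for i
  proof (rule ccontr)
    assume "r i \<noteq> 0"
    define m where "m = Max (r ` {..<n})"
    have le_m: "r j \<le> m" if "j < n" for j
      using that by (auto simp: m_def)
    have "0 < m"
      using \<open>r i \<noteq> 0\<close> r_nonneg[OF i] le_m[OF i] by linarith
    define K where "K = {j. j < n \<and> r j = m}"
    have "m \<in> r ` {..<n}"
      unfolding m_def using i by (intro Max_in) auto
    then have "K \<noteq> {}"
      by (auto simp: K_def)
    moreover have "stochastically_closed A K"
      unfolding stochastically_closed_def
    proof
      fix h assume "h \<in> K"
      then have h: "h < n" "r h = m"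
        by (auto simp: K_def)
      have mean: "(\<Sum>j<n. A $$ (h, j) * r j) = m"
        using r_fix[OF h(1)] h(2) by simp
      have "(\<Sum>j<n. A $$ (h, j) * (m - r j)) = (\<Sum>j<n. A $$ (h, j)) * m - m"
        by (simp add: right_diff_distrib sum_subtractf mean flip: sum_distrib_right)
      \<comment> \<open>Both the missing row mass and the shortfalls \<open>m - r j\<close> enter with a nonnegative sign.\<close>
      then have "m * (1 - (\<Sum>j<n. A $$ (h, j))) + (\<Sum>j<n. A $$ (h, j) * (m - r j)) = 0"
        by (simp add: algebra_simps)
      moreover have "0 \<le> m * (1 - (\<Sum>j<n. A $$ (h, j)))"
        using \<open>0 < m\<close> row[OF h(1)] by simp
      moreover have short: "\<And>j. j \<in> {..<n} \<Longrightarrow> 0 \<le> A $$ (h, j) * (m - r j)"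
        using nn h(1) le_m by simp
      moreover from short have "0 \<le> (\<Sum>j<n. A $$ (h, j) * (m - r j))"
        by (rule sum_nonneg)
      ultimately have full: "m * (1 - (\<Sum>j<n. A $$ (h, j))) = 0"
        and "(\<Sum>j<n. A $$ (h, j) * (m - r j)) = 0"
        by linarith+
      then have "\<forall>j\<in>{..<n}. A $$ (h, j) * (m - r j) = 0"
        using short sum_nonneg_eq_0_iff[of "{..<n}" "\<lambda>j. A $$ (h, j) * (m - r j)"] by auto
      then have "(\<Sum>j\<in>K. A $$ (h, j)) = (\<Sum>j<n. A $$ (h, j))"
        by (intro sum.mono_neutral_left) (auto simp: K_def)
      then show "(\<Sum>j\<in>K. A $$ (h, j)) = 1"
        using full \<open>0 < m\<close> by simp
    qed
    moreover have "K \<subseteq> {..<n}"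
      by (auto simp: K_def)
    ultimately show False
      using no by blast
  qed
  have "(\<lambda>k. (A ^\<^sub>m k) $$ (i, j)) \<longlonglongrightarrow> 0" if ij: "i < n" "j < n" for i j
  proof (rule tendsto_sandwich[where f = "\<lambda>_. 0" and h = "\<lambda>k. s k i"])
    show "\<forall>\<^sub>F k in sequentially. 0 \<le> (A ^\<^sub>m k) $$ (i, j)"
      using pow_mat_nonneg[OF car nn ij] by simp
    have "(A ^\<^sub>m k) $$ (i, j) \<le> s k i" for k
      unfolding s_eq[OF ij(1), symmetric] using ij pow_mat_nonneg[OF car nn]
      by (intro member_le_sum) auto
    then show "\<forall>\<^sub>F k in sequentially. (A ^\<^sub>m k) $$ (i, j) \<le> s k i"
      by simp
    show "(\<lambda>k. s k i) \<longlonglongrightarrow> 0"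
      using r[OF ij(1)] r_zero[OF ij(1)] by simp
  qed simp
  then show ?thesis
    using car by (simp add: transient_mat_def)
qed


section \<open>Cells and transition masses\<close>

text \<open>
  The shift matches matrix indices, which start at \<open>0\<close>, with the cells \<open>D 2, D 3, \<dots>\<close>
  of the complement.
\<close>

abbreviation cell_union :: "(nat \<Rightarrow> 'a set) \<Rightarrow> nat set \<Rightarrow> 'a set" where
  "cell_union D K \<equiv> \<Union>k\<in>K. D (k + 2)"

context noisy_system
begin

text \<open>
  The measure is real valued and an infinite one would collapse to zero, so the first set is
  meant to have finite measure, as a bounded cell does.
\<close>

definition ae_absorbing :: "'a set \<Rightarrow> 'a set \<Rightarrow> bool" where
  "ae_absorbing C S \<longleftrightarrow>
     (\<forall>l\<in>{1..Q}. 0 < p l \<longrightarrow> measure lborel (C - (\<lambda>x. T x (w l)) -` S) = 0)"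

lemma noise_measurable: "\<xi> n \<in> measurable M (count_space (w ` {1..Q}))"
  using noise_indep by (simp add: indep_vars_def)

lemma noise_value: "\<omega> \<in> space M \<Longrightarrow> \<xi> n \<omega> \<in> w ` {1..Q}"
  using measurable_space[OF noise_measurable] by simp

lemma noise_events: "{\<omega> \<in> space M. P (\<xi> n \<omega>)} \<in> events"
proof -
  have "{\<omega> \<in> space M. P (\<xi> n \<omega>)} = \<xi> n -` {v \<in> w ` {1..Q}. P v} \<inter> space M"
    using noise_value by auto
  also have "\<dots> \<in> events"
    by (rule measurable_sets[OF noise_measurable]) auto
  finally show ?thesis .
qed

lemma noise_weight_nonneg: "l \<in> {1..Q} \<Longrightarrow> 0 \<le> p l"
  using noise_distr[of l 0, symmetric] by simp

lemma prob_noise: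
  "\<P>(\<omega> in M. P (\<xi> n \<omega>)) = (\<Sum>l=1..Q. if P (w l) then p l else 0)"
proof -
  let ?J = "{l \<in> {1..Q}. P (w l)}"
  have "{\<omega> \<in> space M. P (\<xi> n \<omega>)} = (\<Union>l\<in>?J. {\<omega> \<in> space M. \<xi> n \<omega> = w l})"
  proof (intro subset_antisym subsetI)
    fix \<omega> assume "\<omega> \<in> {\<omega> \<in> space M. P (\<xi> n \<omega>)}"
    moreover from this obtain l where "l \<in> {1..Q}" "\<xi> n \<omega> = w l"
      using noise_value[of \<omega> n] by blast
    ultimately show "\<omega> \<in> (\<Union>l\<in>?J. {\<omega> \<in> space M. \<xi> n \<omega> = w l})"
      by auto
  qed auto
  also have "prob \<dots> = (\<Sum>l\<in>?J. \<P>(\<omega> in M. \<xi> n \<omega> = w l))"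
  proof (rule finite_measure_finite_Union)
    show "disjoint_family_on (\<lambda>l. {\<omega> \<in> space M. \<xi> n \<omega> = w l}) ?J"
      unfolding disjoint_family_on_def
    proof (intro ballI impI)
      fix l k assume "l \<in> ?J" "k \<in> ?J" "l \<noteq> k"
      then have "w l \<noteq> w k"
        using inj_onD[OF inj_w, of l k] by blast
      then show "{\<omega> \<in> space M. \<xi> n \<omega> = w l} \<inter> {\<omega> \<in> space M. \<xi> n \<omega> = w k} = {}"
        by auto
    qed
    show "(\<lambda>l. {\<omega> \<in> space M. \<xi> n \<omega> = w l}) ` ?J \<subseteq> events"
      using noise_events by (intro image_subsetI) simp
  qed simp
  also have "\<dots> = (\<Sum>l\<in>?J. p l)"
    using noise_distr by (intro sum.cong) auto
  also have "\<dots> = (\<Sum>l=1..Q. if P (w l) then p l else 0)"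
    by (rule sum.inter_filter) simp
  finally show ?thesis .
qed

lemma noise_weights_sum: "(\<Sum>l=1..Q. p l) = 1"
  using prob_noise[of "\<lambda>_. True" 0] prob_space by simp

lemma prob_noise_eq_1D:
  assumes "\<P>(\<omega> in M. P (\<xi> n \<omega>)) = 1" "l \<in> {1..Q}" "0 < p l"
  shows "P (w l)"
proof (rule ccontr)
  assume "\<not> P (w l)"
  then have "(\<Sum>k=1..Q. if P (w k) then p k else 0) < (\<Sum>k=1..Q. p k)"
    using assms(2,3) noise_weight_nonneg by (intro sum_strict_mono_ex1) auto
  then show False
    using assms(1) unfolding prob_noise noise_weights_sum by simp
qed

lemma punctured_borel: "punctured X \<in> sets borel"
  using borel_compact[OF compact_X] by (intro sets.Diff) auto

lemma T_vimage_borel: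
  assumes "l \<in> {1..Q}" "B \<in> sets borel"
  shows "(\<lambda>x. T x (w l)) -` B \<inter> X \<in> sets borel"
proof -
  \<comment> \<open>The origin is fixed by every branch, so it may be added back by hand.\<close>
  have "(\<lambda>x. T x (w l)) -` B \<inter> X =
      ((\<lambda>x. T x (w l)) -` B \<inter> X) \<inter> punctured X \<union> (if 0 \<in> B then {0} else {})"
    using T_equilibrium[OF assms(1)] zero_in_X by auto
  also have "\<dots> \<in> sets borel"
    by (intro sets.Un T_vimage_sets[OF assms]) auto
  finally show ?thesis .
qed

context
  fixes L :: nat and D :: "nat \<Rightarrow> 'a set"
  assumes cells: "cell_partition X L D"
begin

lemma cell_borel: "k < L - 1 \<Longrightarrow> D (k + 2) \<in> sets borel"
  using cells by (auto simp: cell_partition_def)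

lemma cell_subset: "k < L - 1 \<Longrightarrow> D (k + 2) \<subseteq> X"
  using cells by (auto simp: cell_partition_def)

lemma cell_disjoint: "j < L - 1 \<Longrightarrow> k < L - 1 \<Longrightarrow> j \<noteq> k \<Longrightarrow> D (j + 2) \<inter> D (k + 2) = {}"
  using cells by (auto simp: cell_partition_def disjoint_family_on_def)

lemma zero_notin_cell:
  assumes "k < L - 1"
  shows "0 \<notin> D (k + 2)"
proof -
  have "D 1 \<inter> D (k + 2) = {}"
    using cells assms by (intro disjoint_family_onD[of D "{1..L}"]) (auto simp: cell_partition_def)
  moreover have "0 \<in> D 1"
    using cells by (simp add: cell_partition_def)
  ultimately show ?thesis
    by blast
qed

lemma cell_fmeasurable:
  assumes "k < L - 1"
  shows "D (k + 2) \<in> fmeasurable lborel"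
proof (rule fmeasurableI2[of X])
  show "D (k + 2) \<subseteq> X" "D (k + 2) \<in> sets lborel"
    using cell_subset[OF assms] cell_borel[OF assms] by simp_all
  show "X \<in> fmeasurable lborel"
    using compact_X by (rule fmeasurable_compact)
qed

lemma cell_measure_pos: "k < L - 1 \<Longrightarrow> 0 < measure lborel (D (k + 2))"
proof -
  assume k: "k < L - 1"
  then have "emeasure lborel (D (k + 2)) > 0"
    using cells by (auto simp: cell_partition_def)
  then show ?thesis
    unfolding emeasure_eq_measure2[OF cell_fmeasurable[OF k]] by simp
qed

lemma cell_union_borel: "K \<subseteq> {..<L - 1} \<Longrightarrow> cell_union D K \<in> sets borel"
  using cell_borel finite_subset[of K "{..<L - 1}"] by (intro sets.finite_UN) auto

lemma cell_union_subset:
  assumes "K \<subseteq> {..<L - 1}"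
  shows "cell_union D K \<subseteq> punctured X"
proof (rule UN_least)
  fix k assume "k \<in> K"
  then have k: "k < L - 1"
    using assms by auto
  show "D (k + 2) \<subseteq> punctured X"
    using cell_subset[OF k] zero_notin_cell[OF k] by blast
qed

lemma cell_union_subset_complement: "K \<subseteq> {..<L - 1} \<Longrightarrow> cell_union D K \<subseteq> complement_cells L D"
  unfolding complement_cells_def by (intro UN_least UN_upper) auto

text \<open>
  The row mass that a row lacks on a set of columns is exactly the average share of the cell
  that the branches throw outside the corresponding union of cells. This one formula yields both
  substochasticity and the measure theoretic meaning of closed sets of states.
\<close>

lemma sub_Markov_mat_row_sum:
  assumes K: "K \<subseteq> {..<L - 1}" and i: "i < L - 1"
  shows "(\<Sum>j\<in>K. sub_Markov_mat X T Q w p L D $$ (i, j)) =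
    1 - (\<Sum>l=1..Q. p l * (measure lborel (D (i + 2) - (\<lambda>x. T x (w l)) -` cell_union D K) /
                        measure lborel (D (i + 2))))"
proof -
  let ?C = "D (i + 2)"
  let ?S = "cell_union D K"
  let ?m = "measure lborel"
  let ?v = "\<lambda>l B. ((\<lambda>x. T x (w l)) -` B \<inter> X) \<inter> ?C"
  have fin: "finite K"
    using K finite_subset by blast
  have v_fm: "?v l B \<in> fmeasurable lborel" if "l \<in> {1..Q}" "B \<in> sets borel" for l B
    using cell_fmeasurable[OF i] T_vimage_borel[OF that]
    by (metis fmeasurable_Int_fmeasurable inf_commute sets_lborel)
  have split: "(\<Sum>j\<in>K. ?m (?v l (D (j + 2)))) = ?m ?C - ?m (?C - (\<lambda>x. T x (w l)) -` ?S)"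
    if l: "l \<in> {1..Q}" for l
  proof -
    have "(\<Sum>j\<in>K. ?m (?v l (D (j + 2)))) = ?m (\<Union>j\<in>K. ?v l (D (j + 2)))"
    proof (rule measure_UNION_AE[symmetric, OF fin])
      show "?v l (D (j + 2)) \<in> fmeasurable lborel" if "j \<in> K" for j
        using K that by (intro v_fm[OF l] cell_borel) auto
      show "pairwise (\<lambda>j k. AE x in lborel. x \<notin> ?v l (D (j + 2)) \<or> x \<notin> ?v l (D (k + 2))) K"
        using K cell_disjoint by (intro pairwiseI AE_I2) blast
    qed
    also have "(\<Union>j\<in>K. ?v l (D (j + 2))) = ?v l ?S"
      by blast
    also have "?m (?v l ?S) = ?m ?C - ?m (?C - ?v l ?S)"
      using measurable_measure_Diff[of ?C lborel "?v l ?S"] cell_fmeasurable[OF i]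
        v_fm[OF l cell_union_borel[OF K]] by (auto simp: fmeasurable_def)
    also have "?C - ?v l ?S = ?C - (\<lambda>x. T x (w l)) -` ?S"
      using cell_subset[OF i] by auto
    finally show ?thesis .
  qed
  have "(\<Sum>j\<in>K. sub_Markov_mat X T Q w p L D $$ (i, j)) =
      (\<Sum>j\<in>K. \<Sum>l=1..Q. p l * (?m (?v l (D (j + 2))) / ?m ?C))"
    using K i by (intro sum.cong refl) (auto simp: sub_Markov_mat_def)
  also have "\<dots> = (\<Sum>l=1..Q. p l * ((\<Sum>j\<in>K. ?m (?v l (D (j + 2)))) / ?m ?C))"
    by (subst sum.swap) (simp add: sum_distrib_left sum_divide_distrib)
  also have "\<dots> = (\<Sum>l=1..Q. p l - p l * (?m (?C - (\<lambda>x. T x (w l)) -` ?S) / ?m ?C))"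
    using cell_measure_pos[OF i]
    by (intro sum.cong refl) (simp only: split, simp add: field_simps)
  also have "\<dots> = 1 - (\<Sum>l=1..Q. p l * (?m (?C - (\<lambda>x. T x (w l)) -` ?S) / ?m ?C))"
    by (simp only: sum_subtractf noise_weights_sum)
  finally show ?thesis .
qed

lemma substochastic_sub_Markov_mat: "substochastic_mat (L - 1) (sub_Markov_mat X T Q w p L D)"
  unfolding substochastic_mat_def
proof (intro conjI allI impI)
  fix i assume i: "i < L - 1"
  have "0 \<le> (\<Sum>l=1..Q. p l * (measure lborel (D (i + 2) - (\<lambda>x. T x (w l)) -` cell_union D {..<L - 1}) /
                        measure lborel (D (i + 2))))"
    using noise_weight_nonneg by (intro sum_nonneg) auto
  then show "(\<Sum>j<L - 1. sub_Markov_mat X T Q w p L D $$ (i, j)) \<le> 1"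
    using sub_Markov_mat_row_sum[OF subset_refl i] by linarith
next
  fix i j assume "i < L - 1" "j < L - 1"
  then show "0 \<le> sub_Markov_mat X T Q w p L D $$ (i, j)"
    using noise_weight_nonneg by (auto simp: sub_Markov_mat_def intro!: sum_nonneg)
qed (simp add: sub_Markov_mat_def)

lemma stochastically_closed_iff_ae_absorbing:
  assumes K: "K \<subseteq> {..<L - 1}"
  shows "stochastically_closed (sub_Markov_mat X T Q w p L D) K \<longleftrightarrow>
    (\<forall>i\<in>K. ae_absorbing (D (i + 2)) (cell_union D K))"
  unfolding stochastically_closed_def
proof (rule ball_cong[OF refl])
  fix i assume "i \<in> K"
  then have i: "i < L - 1"
    using K by auto
  let ?t = "\<lambda>l. p l * (measure lborel (D (i + 2) - (\<lambda>x. T x (w l)) -` cell_union D K) /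
                        measure lborel (D (i + 2)))"
  have "(\<Sum>l=1..Q. ?t l) = 0 \<longleftrightarrow> (\<forall>l\<in>{1..Q}. ?t l = 0)"
    using noise_weight_nonneg by (intro sum_nonneg_eq_0_iff) auto
  also have "\<dots> \<longleftrightarrow> ae_absorbing (D (i + 2)) (cell_union D K)"
    unfolding ae_absorbing_def using noise_weight_nonneg cell_measure_pos[OF i] by force
  finally show "(\<Sum>j\<in>K. sub_Markov_mat X T Q w p L D $$ (i, j)) = 1 \<longleftrightarrow>
      ae_absorbing (D (i + 2)) (cell_union D K)"
    unfolding sub_Markov_mat_row_sum[OF K i] by linarith
qed

lemma transient_sub_Markov_mat_iff:
  "transient_mat (sub_Markov_mat X T Q w p L D) \<longleftrightarrow>
   (\<nexists>K. K \<subseteq> {..<L - 1} \<and> K \<noteq> {} \<and> (\<forall>i\<in>K. ae_absorbing (D (i + 2)) (cell_union D K)))"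
  using substochastic_sub_Markov_mat stochastically_closed_iff_ae_absorbing
    no_stochastically_closed_imp_transient[OF substochastic_sub_Markov_mat]
    stochastically_closed_imp_not_transient[of "sub_Markov_mat X T Q w p L D" "L - 1"]
  unfolding substochastic_mat_def by metis

section \<open>Lyapunov measures and coarse stability\<close>

text \<open>
  A union of cells that absorbs itself up to a Lebesgue null set is mapped into itself up to a
  null set of every measure equivalent to Lebesgue measure. Averaging over the branches then
  gives at least as much mass as before, which is the reverse of the Lyapunov inequality. The
  bound is stated in the extended reals, so infinite mass needs no separate treatment.
\<close>

lemma emeasure_le_sub_Markov_op:
  assumes \<mu>: "equivalent_measures \<mu> (restrict_space lborel (punctured X))"
    and K: "K \<subseteq> {..<L - 1}"
    and abs: "\<forall>i\<in>K. ae_absorbing (D (i + 2)) (cell_union D K)"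
  shows "emeasure \<mu> (cell_union D K) \<le> emeasure (sub_Markov_op X T Q w p \<mu>) (cell_union D K)"
proof -
  let ?S = "cell_union D K"
  let ?v = "\<lambda>l. ((\<lambda>x. T x (w l)) -` ?S \<inter> X) \<inter> punctured X"
  have sets_\<mu>: "sets \<mu> = sets (restrict_space borel (punctured X))"
    using \<mu> by (simp add: equivalent_measures_def sets_restrict_space)
  have mem: "B \<in> sets \<mu> \<longleftrightarrow> B \<in> sets borel \<and> B \<subseteq> punctured X" for B
    unfolding sets_\<mu> using punctured_borel by (subst sets_restrict_space_iff) auto
  have S: "?S \<in> sets \<mu>"
    using cell_union_borel[OF K] cell_union_subset[OF K] by (simp add: mem)
  have v: "?v l \<in> sets \<mu>" if "l \<in> {1..Q}" for l
    using T_vimage_sets[OF that cell_union_borel[OF K]] by (auto simp: mem)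
  have le: "ennreal (p l) * emeasure \<mu> ?S \<le> ennreal (p l) * emeasure \<mu> (?v l)" if l: "l \<in> {1..Q}" for l
  proof (cases "0 < p l")
    case True
    have null: "D (i + 2) - ?v l \<in> null_sets lborel" if "i \<in> K" for i
    proof -
      have i: "i < L - 1"
        using K that by auto
      have eq: "D (i + 2) - ?v l = D (i + 2) - (\<lambda>x. T x (w l)) -` ?S"
        using cell_subset[OF i] zero_notin_cell[OF i] by auto
      have "D (i + 2) - ?v l \<in> fmeasurable lborel"
        using cell_fmeasurable[OF i] v[OF l] by (intro fmeasurable.Diff fmeasurable_Diff) (auto simp: mem)
      moreover have "measure lborel (D (i + 2) - ?v l) = 0"
        unfolding eq using abs that l True by (simp add: ae_absorbing_def)
      ultimately show ?thesis
        by (auto simp only: null_sets_def emeasure_eq_measure2 ennreal_0 intro: fmeasurableD)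
    qed
    have "?S - ?v l = (\<Union>i\<in>K. D (i + 2) - ?v l)"
      by blast
    also have "\<dots> \<in> null_sets lborel"
      using null K finite_subset by (intro null_sets_UN' countable_finite) auto
    finally have "emeasure lborel (?S - ?v l) = 0"
      by auto
    then have "emeasure (restrict_space lborel (punctured X)) (?S - ?v l) = 0"
      using cell_union_subset[OF K] punctured_borel by (subst emeasure_restrict_space) auto
    then have "emeasure \<mu> (?S - ?v l) = 0"
      using \<mu> S v[OF l] by (auto simp: equivalent_measures_def)
    then have "emeasure \<mu> ?S \<le> emeasure \<mu> (?v l)"
      using emeasure_mono[of ?S "?v l \<union> (?S - ?v l)" \<mu>]
        emeasure_subadditive[of "?v l" \<mu> "?S - ?v l"] S v[OF l] by auto
    then show ?thesis
      by (rule mult_left_mono) simp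
  qed (simp add: ennreal_neg)
  have "emeasure \<mu> ?S = ennreal (\<Sum>l=1..Q. p l) * emeasure \<mu> ?S"
    unfolding noise_weights_sum by simp
  also have "\<dots> = (\<Sum>l=1..Q. ennreal (p l) * emeasure \<mu> ?S)"
    using noise_weight_nonneg by (subst sum_ennreal[symmetric]) (auto simp only: sum_distrib_right)
  also have "\<dots> \<le> (\<Sum>l=1..Q. ennreal (p l) * emeasure \<mu> (?v l))"
    using le by (rule sum_mono)
  also have "\<dots> = emeasure (sub_Markov_op X T Q w p \<mu>) ?S"
    using S unfolding sets_\<mu> by (intro emeasure_sub_Markov_op[OF sets_\<mu>, symmetric])
  finally show ?thesis .
qed

lemma Lyapunov_measure_imp_transient:
  assumes Lyap: "Lyapunov_measure X T Q w p (complement_cells L D) \<mu>"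
    and equiv: "equivalent_measures \<mu> (restrict_space lborel (punctured X))"
  shows "transient_mat (sub_Markov_mat X T Q w p L D)"
  unfolding transient_sub_Markov_mat_iff
proof (intro notI, elim exE conjE)
  fix K assume K: "K \<subseteq> {..<L - 1}" "K \<noteq> {}"
    and abs: "\<forall>i\<in>K. ae_absorbing (D (i + 2)) (cell_union D K)"
  let ?S = "cell_union D K"
  obtain i where i: "i \<in> K"
    using K(2) by blast
  have "0 < emeasure lborel (D (i + 2))"
    using cells i K(1) by (auto simp: cell_partition_def)
  also have "\<dots> \<le> emeasure lborel ?S"
    using i cell_union_borel[OF K(1)] by (intro emeasure_mono) auto
  also have "\<dots> = emeasure (restrict_space lborel (punctured X)) ?S"
    using cell_union_subset[OF K(1)] punctured_borel by (subst emeasure_restrict_space) auto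
  finally have "emeasure (restrict_space lborel (punctured X)) ?S \<noteq> 0"
    by simp
  moreover have "?S \<in> sets \<mu>"
    using equiv cell_union_subset[OF K(1)] cell_union_borel[OF K(1)] punctured_borel
    by (simp add: equivalent_measures_def sets_restrict_space_iff)
  ultimately have "0 < emeasure \<mu> ?S"
    using equiv by (auto simp: equivalent_measures_def zero_less_iff_neq_zero)
  moreover have "?S \<in> sets (restrict_space borel (complement_cells L D))"
    using cell_union_borel[OF K(1)] cell_union_subset_complement[OF K(1)]
    by (auto simp: sets_restrict_space image_iff)
  ultimately have "emeasure (sub_Markov_op X T Q w p \<mu>) ?S < emeasure \<mu> ?S"
    using Lyap by (simp add: Lyapunov_measure_def)
  with emeasure_le_sub_Markov_op[OF equiv K(1) abs] show False
    by simp
qed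

text \<open>
  Almost sure invariance means that every branch of positive weight maps the domain of the
  subpartition into itself, so its cells form a closed set of states.
\<close>

lemma transient_imp_coarse_stable:
  assumes "transient_mat (sub_Markov_mat X T Q w p L D)"
  shows "coarse_stable M \<xi> X T L D"
  unfolding coarse_stable_def
proof (intro allI impI notI, elim exE conjE)
  fix I assume I: "I \<subseteq> {2..L}" "I \<noteq> {}" and inv: "invariant_as M \<xi> T (\<Union>k\<in>I. D k)"
  define K where "K = {k. k + 2 \<in> I}"
  have "I = (\<lambda>k. k + 2) ` K"
  proof (intro subset_antisym subsetI)
    fix k assume "k \<in> I"
    moreover from this obtain j where "k = j + 2"
      using I(1) by (metis atLeastAtMost_iff le_add_diff_inverse2 subsetD)
    ultimately show "k \<in> (\<lambda>k. k + 2) ` K"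
      by (auto simp: K_def)
  qed (auto simp: K_def)
  then have dom: "(\<Union>k\<in>I. D k) = cell_union D K" and "K \<noteq> {}"
    using I(2) by auto
  have "K \<subseteq> {..<L - 1}"
    using I(1) by (auto simp: K_def)
  moreover have "ae_absorbing (D (i + 2)) (cell_union D K)" if "i \<in> K" for i
    unfolding ae_absorbing_def
  proof (intro ballI impI)
    fix l assume l: "l \<in> {1..Q}" "0 < p l"
    have "T x (w l) \<in> cell_union D K" if "x \<in> D (i + 2)" for x
    proof (rule prob_noise_eq_1D[where P = "\<lambda>v. T x v \<in> cell_union D K", OF _ l])
      show "\<P>(\<omega> in M. T x (\<xi> 0 \<omega>) \<in> cell_union D K) = 1"
        using inv \<open>i \<in> K\<close> that unfolding dom invariant_as_def by blast
    qed
    then have "D (i + 2) - (\<lambda>x. T x (w l)) -` cell_union D K = {}"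
      by blast
    then show "measure lborel (D (i + 2) - (\<lambda>x. T x (w l)) -` cell_union D K) = 0"
      by (simp only: measure_empty)
  qed
  ultimately show False
    using assms \<open>K \<noteq> {}\<close> unfolding transient_sub_Markov_mat_iff by blast
qed

end

end

theorem theorem30:
  fixes M :: "'o measure"
    and \<xi> :: "nat \<Rightarrow> 'o \<Rightarrow> 'w"
    and X \<O> :: "'a :: euclidean_space set"
    and T :: "'a \<Rightarrow> 'w \<Rightarrow> 'a"
    and Q L :: nat
    and w :: "nat \<Rightarrow> 'w"
    and p :: "nat \<Rightarrow> real"
    and D :: "nat \<Rightarrow> 'a set"
  assumes system: "noisy_system M \<xi> X T Q w p"
    and local_stability: "locally_stable M \<xi> X T \<O>"
    and cells: "cell_partition X L D"
    and local_domain: "\<O> \<subseteq> D 1 \<or> D 1 \<subseteq> \<O>"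
  shows "((\<exists>\<mu>. Lyapunov_measure X T Q w p (complement_cells L D) \<mu> \<and>
                equivalent_measures \<mu> (restrict_space lborel (punctured X)))
            \<longrightarrow> transient_mat (sub_Markov_mat X T Q w p L D)) \<and>
         (transient_mat (sub_Markov_mat X T Q w p L D) \<longrightarrow> coarse_stable M \<xi> X T L D)"
  using noisy_system.Lyapunov_measure_imp_transient[OF system cells]
    noisy_system.transient_imp_coarse_stable[OF system cells] by blast

end
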